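(* Let $G$ be a group, let $R$ and $T$ be $G$-graded rings, let $f:R\rightarrow T$ be a graded ring epimorphism, and let $J$ be a graded right ideal of $T$ such that $f^{-1}(J)$ is a graded almost prime right ideal of $R$. Then $J$ is a graded almost prime right ideal of $T$.
   Context: Rings are associative, not assumed commutative, and not assumed to have a unity. A ring $R$ is $G$-graded if $R=\bigoplus_{g\in G}R_g$ with $R_g$ additive subgroups and $R_gR_h\subseteq R_{gh}$ for all $g,h\in G$; $x_g$ denotes the component of $x\in R$ in $R_g$. A right ideal $P$ is graded if $P=\bigoplus_{g\in G}(P\cap R_g)$, i.e. $x\in P$ implies $x_g\in P$ for all $g\in G$. The product $XY$ of right ideals is the set of finite sums of products $xy$ with $x\in X$, $y\in Y$, and $P^2=PP$. A ring homomorphism $f:R\to T$ of $G$-graded rings is graded if $f(R_g)\subseteq T_g$ for all $g\in G$; "epimorphism" means surjective homomorphism. A proper graded right ideal $P$ of a graded ring $R$ is graded almost prime if, for all graded right ideals $X,Y$ of $R$, $XY\subseteq P$ and $XY\nsubseteq P^2$ imply $X\subseteq P$ or $Y\subseteq P$. *)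

theory Defs
  imports Main
begin

text \<open>
  Rings are types of class \<^class>\<open>ring\<close>, which is associative but requires neither commutativity nor
  a unity. The grading group is a type of class \<^class>\<open>group_add\<close>; despite the additive notation,
  that class does not require commutativity, so \<open>g + h\<close> stands for the product \<open>gh\<close> in an
  arbitrary group.
\<close>

definition add_subgroup :: "'a::group_add set \<Rightarrow> bool" where
  "add_subgroup H \<longleftrightarrow> 0 \<in> H \<and> (\<forall>x\<in>H. \<forall>y\<in>H. x + y \<in> H) \<and> (\<forall>x\<in>H. - x \<in> H)"

definition homogeneous_decomp ::
  "('g \<Rightarrow> 'a::ring set) \<Rightarrow> 'a \<Rightarrow> ('g \<Rightarrow> 'a) \<Rightarrow> bool" where
  "homogeneous_decomp A x c \<longleftrightarrow>
     (\<forall>g. c g \<in> A g) \<and> finite {g. c g \<noteq> 0} \<and> x = (\<Sum>g | c g \<noteq> 0. c g)"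

text \<open>
  The internal direct sum condition is the existence and uniqueness of homogeneous decompositions.
\<close>

definition grading :: "('g::group_add \<Rightarrow> 'a::ring set) \<Rightarrow> bool" where
  "grading A \<longleftrightarrow>
     (\<forall>g. add_subgroup (A g)) \<and>
     (\<forall>x. \<exists>!c. homogeneous_decomp A x c) \<and>
     (\<forall>g h. \<forall>x\<in>A g. \<forall>y\<in>A h. x * y \<in> A (g + h))"

definition homogeneous_component :: "('g::group_add \<Rightarrow> 'a::ring set) \<Rightarrow> 'a \<Rightarrow> 'g \<Rightarrow> 'a" where
  "homogeneous_component A x = (THE c. homogeneous_decomp A x c)"

definition right_ideal :: "'a::ring set \<Rightarrow> bool" where
  "right_ideal P \<longleftrightarrow> add_subgroup P \<and> (\<forall>x\<in>P. \<forall>r. x * r \<in> P)"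

definition graded_right_ideal :: "('g::group_add \<Rightarrow> 'a::ring set) \<Rightarrow> 'a set \<Rightarrow> bool" where
  "graded_right_ideal A P \<longleftrightarrow>
     right_ideal P \<and> (\<forall>x\<in>P. \<forall>g. homogeneous_component A x g \<in> P)"

definition ideal_prod :: "'a::ring set \<Rightarrow> 'a set \<Rightarrow> 'a set" where
  "ideal_prod X Y =
     {(\<Sum>i<n. x i * y i) | (n::nat) x y. \<forall>i<n. x i \<in> X \<and> y i \<in> Y}"

definition graded_almost_prime :: "('g::group_add \<Rightarrow> 'a::ring set) \<Rightarrow> 'a set \<Rightarrow> bool" where
  "graded_almost_prime A P \<longleftrightarrow>
     graded_right_ideal A P \<and> P \<noteq> UNIV \<and>
     (\<forall>X Y. graded_right_ideal A X \<longrightarrow> graded_right_ideal A Y \<longrightarrow>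
        ideal_prod X Y \<subseteq> P \<longrightarrow> \<not> ideal_prod X Y \<subseteq> ideal_prod P P \<longrightarrow> X \<subseteq> P \<or> Y \<subseteq> P)"

definition graded_ring_hom ::
  "('g::group_add \<Rightarrow> 'a::ring set) \<Rightarrow> ('g \<Rightarrow> 'b::ring set) \<Rightarrow> ('a \<Rightarrow> 'b) \<Rightarrow> bool" where
  "graded_ring_hom A B f \<longleftrightarrow>
     (\<forall>x y. f (x + y) = f x + f y) \<and> (\<forall>x y. f (x * y) = f x * f y) \<and> (\<forall>g. f ` A g \<subseteq> B g)"

end

theory Submission
  imports Defs
begin

text \<open>
  The property descends along \<open>f\<close> because images and preimages under \<open>f\<close> carry all the data of the
  definition back and forth. The image of a product of sets is the product of the images (\<open>image_ideal_prod\<close>), so by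
  surjectivity \<open>f\<close> sends the product of \<open>f\<^sup>-\<^sup>1(X)\<close> and \<open>f\<^sup>-\<^sup>1(Y)\<close> onto \<open>XY\<close>, and the square of
  \<open>f\<^sup>-\<^sup>1(J)\<close> onto \<open>J\<^sup>2\<close>. Hence \<open>XY \<subseteq> J\<close> pulls back to a product inside \<open>f\<^sup>-\<^sup>1(J)\<close>, and a product
  inside the square of \<open>f\<^sup>-\<^sup>1(J)\<close> would push forward to \<open>XY \<subseteq> J\<^sup>2\<close>. A graded homomorphism commutes
  with taking homogeneous components, so the preimages \<open>f\<^sup>-\<^sup>1(X)\<close> and \<open>f\<^sup>-\<^sup>1(Y)\<close> are again graded right
  ideals (\<open>graded_right_ideal_vimage\<close>) and the almost prime hypothesis on \<open>f\<^sup>-\<^sup>1(J)\<close> applies to them. Its conclusion \<open>f\<^sup>-\<^sup>1(X) \<subseteq> f\<^sup>-\<^sup>1(J)\<close>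
  pushes forward to \<open>X \<subseteq> J\<close>, again by surjectivity, and likewise for \<open>Y\<close>.
\<close>

lemma additive_zero:
  fixes f :: "'a::group_add \<Rightarrow> 'b::group_add"
  assumes add: "\<And>x y. f (x + y) = f x + f y"
  shows "f 0 = 0"
proof -
  have "f 0 + f 0 = f 0 + 0"
    using add[of 0 0] by simp
  then show ?thesis
    by (simp only: add_left_cancel)
qed

lemma additive_minus:
  fixes f :: "'a::group_add \<Rightarrow> 'b::group_add"
  assumes add: "\<And>x y. f (x + y) = f x + f y"
  shows "f (- x) = - f x"
proof -
  have "f (- x) + f x = 0"
    using add[of "- x" x] additive_zero[of f] add by simp
  then show ?thesis
    by (simp add: eq_neg_iff_add_eq_0)
qed

lemma additive_sum:
  fixes f :: "'a::ab_group_add \<Rightarrow> 'b::ab_group_add"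
  assumes add: "\<And>x y. f (x + y) = f x + f y"
  shows "f (sum c S) = (\<Sum>i\<in>S. f (c i))"
  by (induction S rule: infinite_finite_induct) (simp_all add: add additive_zero[of f])

lemma image_ideal_prod:
  fixes f :: "'a::ring \<Rightarrow> 'b::ring"
  assumes add: "\<And>x y. f (x + y) = f x + f y" and mult: "\<And>x y. f (x * y) = f x * f y"
  shows "f ` ideal_prod X Y = ideal_prod (f ` X) (f ` Y)"
proof
  show "f ` ideal_prod X Y \<subseteq> ideal_prod (f ` X) (f ` Y)"
  proof
    fix z assume "z \<in> f ` ideal_prod X Y"
    then obtain n :: nat and x y where xy: "\<forall>i<n. x i \<in> X \<and> y i \<in> Y"
      and z: "z = f (\<Sum>i<n. x i * y i)"
      unfolding ideal_prod_def by blast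
    have "z = (\<Sum>i<n. f (x i) * f (y i))"
      using z by (simp add: additive_sum[of f] add mult)
    moreover have "\<forall>i<n. f (x i) \<in> f ` X \<and> f (y i) \<in> f ` Y"
      using xy by blast
    ultimately show "z \<in> ideal_prod (f ` X) (f ` Y)"
      unfolding ideal_prod_def
      by (intro CollectI exI[of _ n] exI[of _ "\<lambda>i. f (x i)"] exI[of _ "\<lambda>i. f (y i)"]) simp
  qed
  show "ideal_prod (f ` X) (f ` Y) \<subseteq> f ` ideal_prod X Y"
  proof
    fix z assume "z \<in> ideal_prod (f ` X) (f ` Y)"
    then obtain n :: nat and x y where xy: "\<forall>i<n. x i \<in> f ` X \<and> y i \<in> f ` Y"
      and z: "z = (\<Sum>i<n. x i * y i)"
      unfolding ideal_prod_def by blast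
    have "\<forall>i. \<exists>u. i < n \<longrightarrow> u \<in> X \<and> x i = f u"
      using xy by blast
    then obtain u where u: "\<And>i. i < n \<Longrightarrow> u i \<in> X \<and> x i = f (u i)"
      by metis
    have "\<forall>i. \<exists>v. i < n \<longrightarrow> v \<in> Y \<and> y i = f v"
      using xy by blast
    then obtain v where v: "\<And>i. i < n \<Longrightarrow> v i \<in> Y \<and> y i = f (v i)"
      by metis
    have "z = f (\<Sum>i<n. u i * v i)"
      using u v z by (simp add: additive_sum[of f] add mult)
    moreover have "(\<Sum>i<n. u i * v i) \<in> ideal_prod X Y"
      using u v unfolding ideal_prod_def by blast
    ultimately show "z \<in> f ` ideal_prod X Y"
      by blast
  qed
qed

lemma homogeneous_component_decomp:
  assumes "grading A"
  shows "homogeneous_decomp A x (homogeneous_component A x)"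
proof -
  have "\<exists>!c. homogeneous_decomp A x c"
    using assms unfolding grading_def by blast
  then show ?thesis
    unfolding homogeneous_component_def by (rule theI')
qed

lemma homogeneous_component_unique:
  assumes "grading A" and "homogeneous_decomp A x c"
  shows "homogeneous_component A x = c"
proof -
  have "\<exists>!c. homogeneous_decomp A x c"
    using assms(1) unfolding grading_def by blast
  then show ?thesis
    unfolding homogeneous_component_def
    using the1_equality[of "homogeneous_decomp A x" c] assms(2) by blast
qed

text \<open>
  Applying the homomorphism to the decomposition of \<open>x\<close> yields a homogeneous decomposition of \<open>f x\<close>,
  and these are unique. Its support may shrink, since \<open>f\<close> can kill nonzero components.
\<close>

lemma homogeneous_component_hom:
  assumes A: "grading A" and B: "grading B" and f: "graded_ring_hom A B f"
  shows "homogeneous_component B (f x) g = f (homogeneous_component A x g)"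
proof -
  have add: "\<And>x y. f (x + y) = f x + f y"
    using f unfolding graded_ring_hom_def by blast
  have f0: "f 0 = 0"
    using add by (rule additive_zero)
  define c where "c = homogeneous_component A x"
  have c: "\<And>g. c g \<in> A g" and fin: "finite {g. c g \<noteq> 0}" and x: "x = (\<Sum>g | c g \<noteq> 0. c g)"
    using homogeneous_component_decomp[OF A, of x]
    unfolding homogeneous_decomp_def c_def by blast+
  have sub: "{g. f (c g) \<noteq> 0} \<subseteq> {g. c g \<noteq> 0}"
    using f0 by auto
  have "f x = (\<Sum>g | c g \<noteq> 0. f (c g))"
    using additive_sum[of f c "{g. c g \<noteq> 0}", OF add] x by simp
  also have "\<dots> = (\<Sum>g | f (c g) \<noteq> 0. f (c g))"
    using fin sub by (intro sum.mono_neutral_right) auto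
  finally have "f x = (\<Sum>g | f (c g) \<noteq> 0. f (c g))" .
  moreover have "\<forall>g. f (c g) \<in> B g"
    using f c unfolding graded_ring_hom_def by blast
  ultimately have "homogeneous_decomp B (f x) (\<lambda>g. f (c g))"
    using finite_subset[OF sub fin] unfolding homogeneous_decomp_def by blast
  then show ?thesis
    using homogeneous_component_unique[OF B] by (simp add: c_def)
qed

lemma graded_right_ideal_vimage:
  assumes "grading A" and "grading B" and f: "graded_ring_hom A B f"
    and X: "graded_right_ideal B X"
  shows "graded_right_ideal A (f -` X)"
proof -
  have add: "\<And>x y. f (x + y) = f x + f y" and mult: "\<And>x y. f (x * y) = f x * f y"
    using f unfolding graded_ring_hom_def by blast+
  have f0: "f 0 = 0"
    using add by (rule additive_zero)
  have fminus: "f (- x) = - f x" for x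
    using add by (rule additive_minus)
  have "right_ideal (f -` X)"
    using X unfolding graded_right_ideal_def right_ideal_def add_subgroup_def
    by (simp add: add mult f0 fminus)
  moreover have "\<forall>x\<in>f -` X. \<forall>g. homogeneous_component A x g \<in> f -` X"
    using X unfolding graded_right_ideal_def
    by (simp add: homogeneous_component_hom[OF assms(1-3), symmetric])
  ultimately show ?thesis
    unfolding graded_right_ideal_def by blast
qed

theorem corollary2p13:
  fixes A :: "'g::group_add \<Rightarrow> 'r::ring set"
    and B :: "'g \<Rightarrow> 't::ring set"
    and f :: "'r \<Rightarrow> 't"
    and J :: "'t set"
  assumes "grading A" and "grading B"
    and "graded_ring_hom A B f" and "surj f"
    and "graded_right_ideal B J"
    and "graded_almost_prime A (f -` J)"
  shows "graded_almost_prime B J"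
proof -
  have add: "\<And>x y. f (x + y) = f x + f y" and mult: "\<And>x y. f (x * y) = f x * f y"
    using assms(3) unfolding graded_ring_hom_def by blast+
  have image_prod: "f ` ideal_prod (f -` X) (f -` Y) = ideal_prod X Y" for X Y
  proof -
    have "f ` ideal_prod (f -` X) (f -` Y) = ideal_prod (f ` (f -` X)) (f ` (f -` Y))"
      using add mult by (rule image_ideal_prod)
    then show ?thesis
      by (simp only: surj_image_vimage_eq[OF assms(4)])
  qed
  have vimage_mono_cancel: "U \<subseteq> J" if "f -` U \<subseteq> f -` J" for U
    using image_mono[OF that, of f] by (simp only: surj_image_vimage_eq[OF assms(4)])
  have prime: "f -` X \<subseteq> f -` J \<or> f -` Y \<subseteq> f -` J"
    if "graded_right_ideal A (f -` X)" and "graded_right_ideal A (f -` Y)"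
      and "ideal_prod (f -` X) (f -` Y) \<subseteq> f -` J"
      and "\<not> ideal_prod (f -` X) (f -` Y) \<subseteq> ideal_prod (f -` J) (f -` J)" for X Y
    using assms(6) that unfolding graded_almost_prime_def by blast
  have "X \<subseteq> J \<or> Y \<subseteq> J"
    if X: "graded_right_ideal B X" and Y: "graded_right_ideal B Y"
      and sub: "ideal_prod X Y \<subseteq> J" and nsub: "\<not> ideal_prod X Y \<subseteq> ideal_prod J J" for X Y
  proof -
    have "ideal_prod (f -` X) (f -` Y) \<subseteq> f -` J"
      using sub by (simp add: image_subset_iff_subset_vimage[symmetric] image_prod)
    moreover have "\<not> ideal_prod (f -` X) (f -` Y) \<subseteq> ideal_prod (f -` J) (f -` J)"
    proof
      assume "ideal_prod (f -` X) (f -` Y) \<subseteq> ideal_prod (f -` J) (f -` J)"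
      from image_mono[OF this, of f] show False
        using nsub by (simp only: image_prod)
    qed
    ultimately have "f -` X \<subseteq> f -` J \<or> f -` Y \<subseteq> f -` J"
      by (intro prime graded_right_ideal_vimage[OF assms(1-3)] X Y)
    then show ?thesis
      using vimage_mono_cancel by blast
  qed
  moreover have "J \<noteq> UNIV"
    using assms(6) unfolding graded_almost_prime_def by fastforce
  ultimately show ?thesis
    using assms(5) unfolding graded_almost_prime_def by blast
qed

end
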